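(* Let $d\in\mathbb{N}_0$ and $F(x)=\sum_{p=0}^da_px^p\in\mathbb{Q}[x]$. Then for all $n\in\mathbb{N}$, $$\sum_{m=1}^nF(m)H_{m-1}^4=H_n^4\sum_{m=1}^nF(m)+\sum_{j=0}^3Q_j(n)H_n^j+P(n)H_n(2)+2F(B)H_n(2,1)+F(B)H_n(3),$$ where $F(B)=\sum_{p=0}^da_pB_p$, and $P$, $Q_0,\dots,Q_3$ are polynomials of degree at most $d+1$ given by \begin{align*} P(n)&=\sum_{p=0}^da_p\Big(-6D^{(p)}(B)+4D^{(p)}(n)+\frac p2B_{p-1}\Big),\\ Q_0(n)&=\sum_{p=0}^da_p\Big(24C^{(p)}_{0,0,0,0}(n)-12C^{(p)}_{0,0,1}(n)-12C^{(p)}_{0,1,1}(n)-12C^{(p)}_{1,1,1}(n)+4C^{(p)}_{0,2}(n)+6C^{(p)}_{1,2}(n)+4C^{(p)}_{2,2}(n)-C^{(p)}_3(n)\Big),\\ Q_1(n)&=\sum_{p=0}^da_p\Big(-24C^{(p)}_{0,0,0}(n)-12D^{(p)}_0(B)+12C^{(p)}_{0,1}(n)+12C^{(p)}_{1,1}(n)+2\frac{d}{dx}D^{(p)}(x)\Big|_{x=B}\\ &\qquad\qquad+\frac{6(D^{(p)}(x)-B_p)}{x}\Big|_{x=B}-4C^{(p)}_2(n)-\frac{p(p-1)}{6}B_{p-2}\Big),\\ Q_2(n)&=\sum_{p=0}^da_p\Big(12C^{(p)}_{0,0}(n)+6D^{(p)}(B)-6C^{(p)}_1(n)-pB_{p-1}\Big),\\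 Q_3(n)&=\sum_{p=0}^da_p\Big(-4C^{(p)}_0(n)-2B_p\Big). \end{align*}
   Context: For $n\in\mathbb{N}$ and positive integers $k_1,\dots,k_r$, $H_n(k_1,\dots,k_r)=\sum_{n\ge n_1>\dots>n_r>0}n_1^{-k_1}\cdots n_r^{-k_r}$ (zero if $n<r$), $H_n=H_n(1)$, $H_0=0$. Bernoulli numbers: $\frac{te^t}{e^t-1}=\sum_{j\ge0}B_j\frac{t^j}{j!}$ (so $B_1=1/2$); terms $pB_{p-1}$ are $0$ for $p=0$ and $p(p-1)B_{p-2}$ is $0$ for $p\le1$. For $p\in\mathbb{N}_0$, $r\ge1$, $a_2,\dots,a_r\in\mathbb{N}_0$ and $a_1=0$, $$C^{(p)}_{a_2,\dots,a_r}(x)=\sum_{\substack{j_1,\dots,j_r\ge0\\ j_1+\dots+j_r\le p-a_r}}\Big(\prod_{i=1}^r\frac{\binom{p+1-a_i-j_1-\dots-j_{i-1}}{j_i}B_{j_i}}{p+1-a_i-j_1-\dots-j_{i-1}}\Big)x^{p+1-a_r-j_1-\dots-j_r}$$ (empty sum $=0$); for $r=1$ this is $C^{(p)}(x)=\sum_{j=0}^p\binom{p+1}{j}\frac{B_j}{p+1}x^{p+1-j}=$ and $C^{(p)}(n)=\sum_{m=1}^nm^p$. $D^{(p)}_{a_2,\dots,a_r}(x):=C^{(p)}_{a_2,\dots,a_r}(x)/x$ (a polynomial). For a polynomial $G(x)=\sum g_ix^i$, the notation $G(B)$ or $G(x)|_{x=B}$ means $\sum g_iB_i$ (umbral convention);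 $\frac{d}{dx}D^{(p)}(x)|_{x=B}$ and $\frac{D^{(p)}(x)-B_p}{x}|_{x=B}$ mean: first form the polynomial ($D^{(p)}(x)-B_p$ is divisible by $x$), then apply this rule.
   Formalization: In P(n) the printed term 4D^{(p)}(n) is replaced by 4D^{(p)}(B): as printed the identity fails, e.g. for F(x)=x, n=1 the left side is 0 and the right side is 1. *)

theory Defs
  imports "HOL-Computational_Algebra.Computational_Algebra"
begin

text \<open>Multiple harmonic sum over \<open>n \<ge> n\<^sub>1 > \<dots> > n\<^sub>r > 0\<close>; the tuple is a strictly
  decreasing list. The harmonic number is \<open>mhs n [1]\<close>.\<close>

definition mhs :: "nat \<Rightarrow> nat list \<Rightarrow> rat" where
  "mhs n ks =
     (\<Sum>ns \<in> {ns. length ns = length ks \<and> sorted_wrt (>) ns \<and> set ns \<subseteq> {1..n}}.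
        \<Prod>i<length ks. 1 / of_nat (ns ! i) ^ (ks ! i))"

text \<open>The convention is \<open>B\<^sub>1 = 1/2\<close>.\<close>

definition bernoulli_gf :: "rat fps" where
  "bernoulli_gf = (fps_X * fps_exp 1) / (fps_exp 1 - 1)"

definition bernoulli :: "nat \<Rightarrow> rat" where
  "bernoulli j = fact j * fps_nth bernoulli_gf j"

lemma bernoulli_gf_mult: "bernoulli_gf * (fps_exp 1 - 1) = fps_X * fps_exp 1"
proof -
  have "subdegree (fps_exp 1 - 1 :: rat fps) = 1"
    by (rule subdegreeI) auto
  moreover have "fps_exp 1 - 1 \<noteq> (0 :: rat fps)"
    using calculation by auto
  ultimately have "(fps_exp 1 - 1 :: rat fps) dvd fps_X * fps_exp 1"
    by (subst fps_dvd_iff) auto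
  thus ?thesis
    unfolding bernoulli_gf_def by (rule dvd_div_mult_self)
qed

text \<open>\<open>umbral G\<close> is \<open>G(B)\<close>: each power \<open>x\<^sup>i\<close> is replaced by \<open>B\<^sub>i\<close>.\<close>

definition umbral :: "rat poly \<Rightarrow> rat" where
  "umbral G = (\<Sum>i\<le>degree G. coeff G i * bernoulli i)"

text \<open>\<open>C_poly p [a\<^sub>2, \<dots>, a\<^sub>r]\<close>. The list \<open>a = 0 # as\<close> is indexed from \<open>0\<close>, so \<open>a ! i\<close> and
  \<open>js ! i\<close> stand for \<open>a\<^sub>i\<^sub>+\<^sub>1\<close> and \<open>j\<^sub>i\<^sub>+\<^sub>1\<close>. The condition \<open>j\<^sub>1 + \<dots> + j\<^sub>r \<le> p - a\<^sub>r\<close> is written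
  without subtraction, so the sum is empty if \<open>p < a\<^sub>r\<close>, and the natural-number
  subtraction in the exponent is never truncated. The quantity \<open>N\<close> is formed in the
  rationals; if \<open>a\<close> is non-decreasing, it is a positive integer and \<open>gchoose\<close> is the
  ordinary binomial coefficient.\<close>

definition C_poly :: "nat \<Rightarrow> nat list \<Rightarrow> rat poly" where
  "C_poly p as =
     (let a = 0 # as; r = length a in
      \<Sum>js \<in> {js. length js = r \<and> sum_list js + last a \<le> p}.
        monom
          (\<Prod>i<r. let N = of_nat (p + 1) - of_nat (a ! i) - of_nat (sum_list (take i js)) :: rat
                  in (N gchoose (js ! i)) * bernoulli (js ! i) / N)
          (p + 1 - last a - sum_list js))"

text \<open>All exponents in \<open>C_poly\<close> are positive, so the division is exact.\<close>

definition D_poly :: "nat \<Rightarrow> nat list \<Rightarrow> rat poly" where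
  "D_poly p as = C_poly p as div [:0, 1:]"

text \<open>In the terms \<open>p B\<^sub>p\<^sub>-\<^sub>1\<close> and \<open>p (p - 1) B\<^sub>p\<^sub>-\<^sub>2\<close> below the truncated indices are harmless,
  since the factors \<open>p\<close> and \<open>p - 1\<close> (taken in the rationals) vanish in those cases.

  The second summand of the coefficient of \<open>H\<^sub>n(2)\<close> is \<open>4 D(B)\<close>. The source prints \<open>4 D(n)\<close>
  there, for which the identity is false: with \<open>F = x\<close> and \<open>n = 1\<close> the left-hand side is
  \<open>0\<close> and the right-hand side would be \<open>1\<close>.\<close>

definition P_poly :: "nat \<Rightarrow> (nat \<Rightarrow> rat) \<Rightarrow> rat poly" where
  "P_poly d a = (\<Sum>p\<le>d. smult (a p)
     [: - 6 * umbral (D_poly p []) + 4 * umbral (D_poly p [])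
        + of_nat p / 2 * bernoulli (p - 1) :])"

definition Q0_poly :: "nat \<Rightarrow> (nat \<Rightarrow> rat) \<Rightarrow> rat poly" where
  "Q0_poly d a = (\<Sum>p\<le>d. smult (a p)
     (24 * C_poly p [0, 0, 0, 0] - 12 * C_poly p [0, 0, 1] - 12 * C_poly p [0, 1, 1]
      - 12 * C_poly p [1, 1, 1] + 4 * C_poly p [0, 2] + 6 * C_poly p [1, 2]
      + 4 * C_poly p [2, 2] - C_poly p [3]))"

definition Q1_poly :: "nat \<Rightarrow> (nat \<Rightarrow> rat) \<Rightarrow> rat poly" where
  "Q1_poly d a = (\<Sum>p\<le>d. smult (a p)
     (- 24 * C_poly p [0, 0, 0] - [: 12 * umbral (D_poly p [0]) :]
      + 12 * C_poly p [0, 1] + 12 * C_poly p [1, 1]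
      + [: 2 * umbral (pderiv (D_poly p [])) :]
      + [: umbral ((6 * (D_poly p [] - [: bernoulli p :])) div [:0, 1:]) :]
      - 4 * C_poly p [2]
      - [: of_nat p * (of_nat p - 1) / 6 * bernoulli (p - 2) :]))"

definition Q2_poly :: "nat \<Rightarrow> (nat \<Rightarrow> rat) \<Rightarrow> rat poly" where
  "Q2_poly d a = (\<Sum>p\<le>d. smult (a p)
     (12 * C_poly p [0, 0] + [: 6 * umbral (D_poly p []) :] - 6 * C_poly p [1]
      - [: of_nat p * bernoulli (p - 1) :]))"

definition Q3_poly :: "nat \<Rightarrow> (nat \<Rightarrow> rat) \<Rightarrow> rat poly" where
  "Q3_poly d a = (\<Sum>p\<le>d. smult (a p)
     (- 4 * C_poly p [0] - [: 2 * bernoulli p :]))"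

end

theory Submission
  imports Defs
begin

text \<open>
  The operator \<open>psum\<close> sends \<open>f\<close> to the polynomial \<open>G\<close> with \<open>G n = f 1 + \<dots> + f n\<close>. Abel summation
  together with \<open>H\<^sub>m = H\<^sub>m\<^sub>-\<^sub>1 + 1/m\<close> expresses \<open>\<Sum> f m H\<^sub>m\<^sub>-\<^sub>1\<^sup>k\<close> through sums of
  \<open>(G m / m\<^sup>i) H\<^sub>m\<^sub>-\<^sub>1\<^sup>k\<^sup>-\<^sup>i\<close>. The polynomial part of \<open>G m / m\<^sup>i\<close> feeds the recursion on \<open>k\<close> and
  produces the \<open>C\<close>-polynomials, which are iterates of "drop low coefficients, divide by a power of
  \<open>x\<close>, apply \<open>psum\<close>". The singular part involves the three lowest coefficients of \<open>G\<close>, which are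
  the umbral values, and the sums \<open>\<Sum> H\<^sub>m\<^sub>-\<^sub>1\<^sup>k / m\<^sup>l\<close>, which telescope to powers of \<open>H\<^sub>n\<close>,
  \<open>H\<^sub>n(2)\<close>, \<open>H\<^sub>n(3)\<close> and \<open>H\<^sub>n(2,1)\<close>.
\<close>

section \<open>Power sums as polynomials with Bernoulli coefficients\<close>

lemma umbral_eq_sum: "degree f \<le> N \<Longrightarrow> umbral f = (\<Sum>i\<le>N. coeff f i * bernoulli i)"
  unfolding umbral_def by (rule sum.mono_neutral_left) (auto intro: coeff_eq_0 simp: not_le)

text \<open>The case r = 1 of \<open>C_poly\<close>, kept as a sum over one number instead of
  one-element lists; \<open>C_poly_Nil\<close> identifies the two.\<close>

definition faulhaber :: "nat \<Rightarrow> rat poly" where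
  "faulhaber p =
     (\<Sum>j\<le>p. monom (of_nat ((p + 1) choose j) * bernoulli j / of_nat (p + 1)) (p + 1 - j))"

text \<open>The generating function of the left-hand side is \<open>bernoulli_gf * (exp (n t) - 1)\<close>, which is
  \<open>t (exp t + \<dots> + exp (n t))\<close> by the geometric series.\<close>

lemma poly_faulhaber: "poly (faulhaber p) (of_nat n) = (\<Sum>m=1..n. of_nat m ^ p)"
proof -
  define e where "e = (\<lambda>m::nat. fps_exp (of_nat m :: rat))"
  have e_Suc: "e (Suc m) = fps_exp 1 * e m" for m
    unfolding e_def by (simp add: fps_exp_add_mult)
  have telescope: "(fps_exp 1 - 1) * (\<Sum>m<n. e m) = e n - 1"
    by (induction n) (simp_all add: e_Suc algebra_simps, simp add: e_def)
  have "bernoulli_gf * (e n - 1) = fps_X * (fps_exp 1 * (\<Sum>m<n. e m))"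
    unfolding telescope[symmetric] using bernoulli_gf_mult by (simp add: mult.assoc[symmetric])
  also have "fps_exp 1 * (\<Sum>m<n. e m) = (\<Sum>m<n. e (Suc m))"
    by (simp add: sum_distrib_left e_Suc)
  also have "\<dots> = (\<Sum>m=1..n. e m)"
    by (rule sum.reindex_bij_witness[of _ "\<lambda>i. i - 1" Suc]) auto
  finally have "fps_nth (bernoulli_gf * (e n - 1)) (p + 1) = fps_nth (\<Sum>m=1..n. e m) p"
    by simp
  also have "\<dots> = (\<Sum>m=1..n. of_nat m ^ p) / fact p"
    by (simp add: fps_sum_nth e_def sum_divide_distrib)
  finally have *: "fact p * fps_nth (bernoulli_gf * (e n - 1)) (p + 1) = (\<Sum>m=1..n. of_nat m ^ p)"
    by simp
  have "fps_nth (bernoulli_gf * (e n - 1)) (p + 1) =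
      (\<Sum>j\<le>p + 1. fps_nth bernoulli_gf j * fps_nth (e n - 1) (p + 1 - j))"
    by (simp add: fps_mult_nth atLeast0AtMost)
  \<comment> \<open>The term \<open>j = p + 1\<close> drops out because \<open>e n - 1\<close> has
    constant coefficient 0.\<close>
  also have "\<dots> = (\<Sum>j\<le>p. fps_nth bernoulli_gf j * fps_nth (e n - 1) (p + 1 - j))"
    by (simp add: e_def)
  also have "fact p * \<dots> = poly (faulhaber p) (of_nat n)"
    unfolding faulhaber_def poly_sum sum_distrib_left
  proof (rule sum.cong[OF refl])
    fix j assume "j \<in> {..p}"
    hence j: "j \<le> p" by simp
    have "(of_nat ((p + 1) choose j) :: rat) = fact (p + 1) / (fact j * fact (p + 1 - j))"
      using j by (intro binomial_fact) simp
    hence "of_nat ((p + 1) choose j) / of_nat (p + 1) =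
        (fact p / (fact j * fact (p + 1 - j)) :: rat)"
      by (simp del: of_nat_Suc)
    hence "of_nat ((p + 1) choose j) * bernoulli j / of_nat (p + 1) =
        fact p / (fact j * fact (p + 1 - j)) * bernoulli j"
      by (metis times_divide_eq_left mult.commute)
    thus "fact p * (fps_nth bernoulli_gf j * fps_nth (e n - 1) (p + 1 - j)) =
        poly (monom (of_nat ((p + 1) choose j) * bernoulli j / of_nat (p + 1)) (p + 1 - j)) (of_nat n)"
      using j by (simp add: poly_monom bernoulli_def e_def del: fact_Suc)
  qed
  finally show ?thesis using * by simp
qed

text \<open>Only \<open>j = p + 1 - i\<close> contributes to x^i, and the binomial coefficient is
  symmetric. For i = 0 this index would be p + 1, which lies outside the summation range.\<close>

lemma coeff_faulhaber:
  "i \<noteq> 0 \<Longrightarrow> coeff (faulhaber p) i =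
     (if i \<le> p + 1 then of_nat ((p + 1) choose i) / of_nat (p + 1) * bernoulli (p + 1 - i) else 0)"
proof -
  assume i: "i \<noteq> 0"
  have "coeff (faulhaber p) i =
      (\<Sum>j\<le>p. if j = p + 1 - i \<and> i \<le> p + 1 then
          of_nat ((p + 1) choose i) / of_nat (p + 1) * bernoulli (p + 1 - i) else 0)"
    unfolding faulhaber_def coeff_sum
  proof (rule sum.cong[OF refl])
    fix j assume "j \<in> {..p}"
    hence "(p + 1 choose j) = (p + 1 choose (p + 1 - j))" "p + 1 - (p + 1 - j) = j"
      by (auto intro: binomial_symmetric)
    thus "coeff (monom (of_nat ((p + 1) choose j) * bernoulli j / of_nat (p + 1)) (p + 1 - j)) i =
      (if j = p + 1 - i \<and> i \<le> p + 1 then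
          of_nat ((p + 1) choose i) / of_nat (p + 1) * bernoulli (p + 1 - i) else 0)"
      using \<open>j \<in> {..p}\<close> i by auto
  qed
  also have "\<dots> = (if i \<le> p + 1 then of_nat ((p + 1) choose i) / of_nat (p + 1) * bernoulli (p + 1 - i) else 0)"
    using i by auto
  finally show ?thesis .
qed

lemma coeff_faulhaber_0: "coeff (faulhaber p) 0 = 0"
  by (simp add: faulhaber_def coeff_sum)

lemma coeff_faulhaber_1: "coeff (faulhaber p) 1 = bernoulli p"
  by (simp add: coeff_faulhaber)

text \<open>Source of the terms p B_{p-1} in \<open>P_poly\<close> and \<open>Q2_poly\<close>. At p
  = 0 the truncated index \<open>p - 1\<close> is harmless, as both sides vanish.\<close>

lemma coeff_faulhaber_2: "coeff (faulhaber p) 2 = of_nat p / 2 * bernoulli (p - 1)"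
proof (cases "p = 0")
  case False
  have "(of_nat ((p + 1) choose 2) :: rat) = of_nat (p + 1) * of_nat p / 2"
    by (simp add: binomial_gbinomial gbinomial_prod_rev numeral_2_eq_2 field_simps)
  hence "of_nat ((p + 1) choose 2) / of_nat (p + 1) = (of_nat p / 2 :: rat)"
    by (simp del: of_nat_Suc)
  moreover have "coeff (faulhaber p) 2 = of_nat ((p + 1) choose 2) / of_nat (p + 1) * bernoulli (p - 1)"
    using False by (subst coeff_faulhaber) simp_all
  ultimately show ?thesis by (simp only:)
qed (simp add: coeff_faulhaber)

lemma coeff_faulhaber_3:
  "coeff (faulhaber p) 3 = of_nat p * (of_nat p - 1) / 6 * bernoulli (p - 2)"
proof (cases "p < 2")
  case False
  have "(of_nat ((p + 1) choose 3) :: rat) = of_nat (p + 1) * (of_nat p * (of_nat p - 1)) / 6"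
    by (simp add: binomial_gbinomial gbinomial_prod_rev numeral_3_eq_3 field_simps)
  hence "of_nat ((p + 1) choose 3) / of_nat (p + 1) = (of_nat p * (of_nat p - 1) / 6 :: rat)"
    by (simp del: of_nat_Suc)
  moreover have "p + 1 - 3 = p - 2" by simp
  hence "coeff (faulhaber p) 3 = of_nat ((p + 1) choose 3) / of_nat (p + 1) * bernoulli (p - 2)"
    using False by (subst coeff_faulhaber) simp_all
  ultimately show ?thesis by (simp only:)
next
  case True
  hence "p = 0 \<or> p = 1" by auto
  thus ?thesis by (auto simp: coeff_faulhaber)
qed

section \<open>The summation operator on polynomials\<close>

definition psum :: "rat poly \<Rightarrow> rat poly" where
  "psum f = (\<Sum>p\<le>degree f. smult (coeff f p) (faulhaber p))"

lemma psum_eq_sum: "degree f \<le> N \<Longrightarrow> psum f = (\<Sum>p\<le>N. smult (coeff f p) (faulhaber p))"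
  unfolding psum_def by (rule sum.mono_neutral_left) (auto intro: coeff_eq_0 simp: not_le)

lemma psum_0 [simp]: "psum 0 = 0"
  by (simp add: psum_def)

lemma psum_add: "psum (f + g) = psum f + psum g"
proof -
  let ?N = "max (degree f) (degree g)"
  show ?thesis
    by (simp add: psum_eq_sum[of _ ?N] degree_add_le_max smult_add_left sum.distrib)
qed

lemma psum_sum: "psum (sum f A) = (\<Sum>i\<in>A. psum (f i))"
  by (induction A rule: infinite_finite_induct) (simp_all add: psum_add)

lemma psum_monom: "psum (monom c p) = smult c (faulhaber p)"
proof -
  have "psum (monom c p) = (\<Sum>q\<le>p. smult (coeff (monom c p) q) (faulhaber q))"
    by (rule psum_eq_sum) (rule degree_monom_le)
  also have "\<dots> = (\<Sum>q\<le>p. if p = q then smult c (faulhaber q) else 0)"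
    by (rule sum.cong) auto
  finally show ?thesis by simp
qed

lemma poly_psum: "poly (psum f) (of_nat n) = (\<Sum>m=1..n. poly f (of_nat m))"
proof -
  have "poly (psum f) (of_nat n) = (\<Sum>p\<le>degree f. coeff f p * (\<Sum>m=1..n. of_nat m ^ p))"
    by (simp add: psum_def poly_sum poly_faulhaber)
  also have "\<dots> = (\<Sum>m=1..n. \<Sum>p\<le>degree f. coeff f p * of_nat m ^ p)"
    by (subst sum.swap) (simp add: sum_distrib_left)
  finally show ?thesis by (simp add: poly_altdef)
qed

lemma coeff_psum_0: "coeff (psum f) 0 = 0"
  by (simp add: psum_def coeff_sum coeff_faulhaber_0)

text \<open>By linearity, since \<open>faulhaber p\<close> has linear coefficient B_p; this is how
  umbral values arise from summation.\<close>

lemma coeff_psum_1: "coeff (psum f) 1 = umbral f"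
  by (simp add: psum_def coeff_sum coeff_faulhaber umbral_def)

text \<open>The quadratic coefficient p B_{p-1} / 2 of \<open>faulhaber p\<close> is half the umbral
  value of the derivative of x^p.\<close>

lemma coeff_psum_2: "coeff (psum f) 2 = umbral (pderiv f) / 2"
proof -
  have "coeff (psum f) 2 = (\<Sum>p\<le>degree f. coeff f p * (of_nat p * bernoulli (p - 1) / 2))"
    by (simp add: psum_def coeff_sum coeff_faulhaber_2)
  \<comment> \<open>The term p = 0 has factor 0 and the term p = degree + 1 has coefficient 0, so
    the range can be moved to one that shifts by 1 onto \<open>{..degree f}\<close>.\<close>
  also have "\<dots> = (\<Sum>p\<in>{1..Suc (degree f)}. coeff f p * (of_nat p * bernoulli (p - 1) / 2))"
    by (rule sum.mono_neutral_cong) (auto intro: coeff_eq_0 simp: not_le)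
  also have "\<dots> = (\<Sum>p\<le>degree f. coeff (pderiv f) p * bernoulli p / 2)"
    by (rule sum.reindex_bij_witness[of _ Suc "\<lambda>p. p - 1"])
       (auto simp: coeff_pderiv mult_ac simp del: of_nat_Suc)
  also have "\<dots> = umbral (pderiv f) / 2"
    by (subst umbral_eq_sum[of _ "degree f"])
       (simp_all add: sum_divide_distrib degree_pderiv)
  finally show ?thesis .
qed

section \<open>The polynomials \<open>C_poly\<close> as iterated summations\<close>

lemma smult_sum_right: "smult c (sum f A) = (\<Sum>i\<in>A. smult c (f i))"
  by (induction A rule: infinite_finite_induct) (simp_all add: smult_add_right)

lemma finite_bounded_lists: "finite {js::nat list. length js = r \<and> sum_list js + b \<le> p}"
proof (rule finite_subset)
  show "{js::nat list. length js = r \<and> sum_list js + b \<le> p} \<subseteq>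
      {js. set js \<subseteq> {..p} \<and> length js = r}"
    using member_le_sum_list by fastforce
qed (simp add: finite_lists_length_eq)

lemma poly_shift_sum: "poly_shift k (sum f A) = (\<Sum>i\<in>A. poly_shift k (f i))"
  by (rule poly_eqI) (simp add: coeff_poly_shift coeff_sum)

text \<open>The coefficient of one index tuple in \<open>C_poly\<close>. Here \<open>a\<close>
  includes the leading 0, so appending an entry only adds one factor.\<close>

definition C_weight :: "nat \<Rightarrow> nat list \<Rightarrow> nat list \<Rightarrow> rat" where
  "C_weight p a js =
     (\<Prod>i<length a. let N = of_nat (p + 1) - of_nat (a ! i) - of_nat (sum_list (take i js)) :: rat
        in (N gchoose (js ! i)) * bernoulli (js ! i) / N)"

lemma C_poly_altdef:
  "C_poly p as = (\<Sum>js | length js = length (0 # as) \<and> sum_list js + last (0 # as) \<le> p.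
     monom (C_weight p (0 # as) js) (p + 1 - last (0 # as) - sum_list js))"
  unfolding C_poly_def C_weight_def Let_def ..

text \<open>The new factor depends on \<open>js\<close> only through its sum. The bound on that sum
  makes \<open>N\<close> a positive integer, so \<open>gchoose\<close> is an ordinary binomial
  coefficient.\<close>

lemma C_weight_snoc:
  assumes "length js = length a" "sum_list js + b \<le> p"
  shows "C_weight p (a @ [b]) (js @ [j]) =
    C_weight p a js * (of_nat ((p - b - sum_list js + 1) choose j) * bernoulli j / of_nat (p - b - sum_list js + 1))"
proof -
  have *: "of_nat (p + 1) - of_nat b - of_nat (sum_list js) = (of_nat (p - b - sum_list js + 1) :: rat)"
    using assms(2) by (simp add: of_nat_diff)
  show ?thesis
    unfolding C_weight_def using assms(1) *
    by (simp add: nth_append Let_def binomial_gbinomial del: of_nat_Suc of_nat_add)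
qed

lemma C_poly_Nil: "C_poly p [] = faulhaber p"
  unfolding C_poly_altdef faulhaber_def
  by (rule sum.reindex_bij_witness[of _ "\<lambda>j. [j]" hd])
     (auto simp: C_weight_def Let_def binomial_gbinomial length_Suc_conv)

text \<open>With l the last entry, the shift lowers the exponent p + 1 - l -
  \<open>sum_list js\<close> to q = p - b - \<open>sum_list js\<close>. Terms that would get a
  negative exponent are discarded, which is exactly the stricter bound for b. Summing x^q gives
  \<open>faulhaber q\<close>, whose index is the new last entry of the tuple.\<close>

lemma C_poly_snoc:
  assumes "last (0 # as) \<le> b"
  shows "C_poly p (as @ [b]) = psum (poly_shift (b + 1 - last (0 # as)) (C_poly p as))"
proof -
  let ?l = "last (0 # as)" and ?r = "length (0 # as)"
  let ?k = "b + 1 - ?l"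
  let ?J = "\<lambda>b. {js::nat list. length js = ?r \<and> sum_list js + b \<le> p}"
  let ?q = "\<lambda>js. p - b - sum_list js"
  let ?w = "\<lambda>q j. of_nat ((q + 1) choose j) * bernoulli j / of_nat (q + 1)"
  have "psum (poly_shift ?k (C_poly p as)) =
      (\<Sum>js\<in>?J ?l. psum (poly_shift ?k (monom (C_weight p (0 # as) js) (p + 1 - ?l - sum_list js))))"
    unfolding C_poly_altdef by (simp add: poly_shift_sum psum_sum)
  also have "\<dots> = (\<Sum>js\<in>?J b. smult (C_weight p (0 # as) js) (faulhaber (?q js)))"
  proof (rule sum.mono_neutral_cong_right[OF finite_bounded_lists])
    show "?J b \<subseteq> ?J ?l" using assms by auto
    show "\<forall>js\<in>?J ?l - ?J b. psum (poly_shift ?k (monom (C_weight p (0 # as) js) (p + 1 - ?l - sum_list js))) = 0"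
    proof
      fix js assume "js \<in> ?J ?l - ?J b"
      hence "p + 1 - ?l - sum_list js < ?k" using assms by (auto simp del: last.simps)
      thus "psum (poly_shift ?k (monom (C_weight p (0 # as) js) (p + 1 - ?l - sum_list js))) = 0"
        by (simp add: poly_shift_monom del: last.simps)
    qed
    fix js assume "js \<in> ?J b"
    hence "?k \<le> p + 1 - ?l - sum_list js" "p + 1 - ?l - sum_list js - ?k = ?q js"
      using assms by (auto simp del: last.simps)
    thus "psum (poly_shift ?k (monom (C_weight p (0 # as) js) (p + 1 - ?l - sum_list js))) =
        smult (C_weight p (0 # as) js) (faulhaber (?q js))"
      by (simp only: poly_shift_monom if_True psum_monom)
  qed
  also have "\<dots> = (\<Sum>js\<in>?J b. \<Sum>j\<le>?q js. monom (C_weight p (0 # as) js * ?w (?q js) j) (?q js + 1 - j))"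
    by (simp add: faulhaber_def smult_sum_right smult_monom)
  also have "\<dots> = (\<Sum>(js, j)\<in>Sigma (?J b) (\<lambda>js. {..?q js}).
      monom (C_weight p (0 # as) js * ?w (?q js) j) (?q js + 1 - j))"
    by (rule sum.Sigma) (use finite_bounded_lists in auto)
  also have "\<dots> = C_poly p (as @ [b])"
    unfolding C_poly_altdef
  proof (rule sum.reindex_bij_witness[of _ "\<lambda>js. (butlast js, last js)" "\<lambda>(js, j). js @ [j]"], goal_cases)
    case (4 js)
    then obtain js' j where js: "js = js' @ [j]" by (cases js rule: rev_cases) auto
    with 4 show ?case by auto
  next
    case (5 z)
    then obtain js j where z: "z = (js, j)" "length js = ?r" "sum_list js + b \<le> p" "j \<le> ?q js"
      by auto
    have "C_weight p (0 # as @ [b]) (js @ [j]) = C_weight p (0 # as) js * ?w (?q js) j"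
      using C_weight_snoc[of js "0 # as" b p j] z by simp
    moreover have "p + 1 - last (0 # as @ [b]) - sum_list (js @ [j]) = ?q js + 1 - j"
      using z by simp
    ultimately show ?case by (simp only: z prod.case)
  next
    case (3 js)
    then obtain js' j where js: "js = js' @ [j]" by (cases js rule: rev_cases) auto
    with 3 show ?case by auto
  qed (use assms in force)+
  finally show ?thesis ..
qed

lemma degree_C_poly: "degree (C_poly p as) \<le> p + 1"
  unfolding C_poly_altdef
  by (rule degree_sum_le[OF finite_bounded_lists])
     (rule order.trans[OF degree_monom_le], simp)

text \<open>The constant coefficient is the remainder. This turns \<open>D_poly\<close> into the
  shift that occurs in the recursion.\<close>

lemma div_X_eq_poly_shift: "f div [:0, 1:] = poly_shift 1 f" for f :: "rat poly"
proof -
  have "f = pCons (coeff f 0) (poly_shift 1 f)"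
    by (rule poly_eqI) (simp add: coeff_pCons coeff_poly_shift split: nat.splits)
  hence "f = poly_shift 1 f * [:0, 1:] + [:coeff f 0:]" by simp
  have "(poly_shift 1 f * [:0, 1:] + [:coeff f 0:]) div [:0, 1:] = poly_shift 1 f + [:coeff f 0:] div [:0, 1:]"
    by (rule div_mult_self3) simp
  also have "[:coeff f 0:] div [:0, 1:] = 0"
    by (simp add: div_poly_less)
  finally show ?thesis using \<open>f = poly_shift 1 f * _ + _\<close> by simp
qed

section \<open>Recursion for multiple harmonic sums\<close>

lemma mhs_Nil: "mhs n [] = 1"
proof -
  have "{ns::nat list. length ns = length [] \<and> sorted_wrt (>) ns \<and> set ns \<subseteq> {1..n}} = {[]}"
    by auto
  thus ?thesis unfolding mhs_def by simp
qed

text \<open>Split by the largest index m; the remaining indices lie in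
  \<open>{1..m - 1}\<close>.\<close>

lemma mhs_Cons: "mhs n (k # ks) = (\<Sum>m=1..n. mhs (m - 1) ks / of_nat m ^ k)"
proof -
  let ?A = "\<lambda>n ks. {ns::nat list. length ns = length ks \<and> sorted_wrt (>) ns \<and> set ns \<subseteq> {1..n}}"
  let ?w = "\<lambda>ks ns. \<Prod>i<length ks. 1 / of_nat (ns ! i) ^ (ks ! i) :: rat"
  have fin: "finite (?A n ks)" for n and ks :: "nat list"
    by (rule finite_subset[of _ "{ns. set ns \<subseteq> {1..n} \<and> length ns = length ks}"])
       (auto intro: finite_lists_length_eq)
  have "(\<Sum>m=1..n. mhs (m - 1) ks / of_nat m ^ k) =
      (\<Sum>m=1..n. \<Sum>ns\<in>?A (m - 1) ks. 1 / of_nat m ^ k * ?w ks ns)"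
    unfolding mhs_def by (simp add: sum_divide_distrib)
  also have "\<dots> = (\<Sum>(m, ns)\<in>Sigma {1..n} (\<lambda>m. ?A (m - 1) ks). 1 / of_nat m ^ k * ?w ks ns)"
    by (rule sum.Sigma) (use fin in auto)
  also have "\<dots> = mhs n (k # ks)"
    unfolding mhs_def
  proof (rule sum.reindex_bij_witness[of _ "\<lambda>ns. (hd ns, tl ns)" "\<lambda>(m, ns). m # ns"], goal_cases)
    case (4 ns)
    then show ?case by (cases ns) force+
  next
    case (5 z)
    then show ?case by (auto simp: prod.lessThan_Suc_shift simp del: prod.lessThan_Suc)
  qed (force simp: Suc_le_eq length_Suc_conv)+
  finally show ?thesis ..
qed

lemma mhs_Suc: "mhs (Suc n) (k # ks) = mhs n (k # ks) + mhs n ks / of_nat (Suc n) ^ k"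
  by (simp add: mhs_Cons del: of_nat_Suc)

lemma mhs_0: "mhs 0 (k # ks) = 0"
  by (simp add: mhs_Cons)

section \<open>Abel summation against powers of harmonic numbers\<close>

text \<open>The polynomial \<open>f\<close> is arbitrary so that the recursion on \<open>k\<close>
  can pass to shifts of \<open>psum f\<close>.\<close>

definition hsum :: "nat \<Rightarrow> rat poly \<Rightarrow> nat \<Rightarrow> rat" where
  "hsum k f n = (\<Sum>m=1..n. poly f (of_nat m) * mhs (m - 1) [1] ^ k)"

lemma hsum_0: "hsum k f 0 = 0"
  by (simp add: hsum_def)

lemma hsum_Suc: "hsum k f (Suc n) = hsum k f n + poly f (of_nat (Suc n)) * mhs n [1] ^ k"
  by (simp add: hsum_def del: of_nat_Suc)

lemma poly_psum_Suc:
  "poly (psum f) (of_nat (Suc n)) = poly (psum f) (of_nat n) + poly f (of_nat (Suc n))"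
  unfolding poly_psum by simp

lemma poly_poly_shift_Suc:
  "poly (poly_shift k f) x = coeff f k + x * poly (poly_shift (Suc k) f) x" for x :: rat
proof -
  have "poly_shift k f = pCons (coeff f k) (poly_shift (Suc k) f)"
    by (rule poly_eqI) (simp add: coeff_pCons coeff_poly_shift split: nat.splits)
  thus ?thesis by simp
qed

text \<open>Splits G(x) / x^i into singular and polynomial part; G has no constant term, so the
  singular part has i - 1 terms. Powers of u = 1/x keep everything polynomial in the inductions
  below.\<close>

lemma poly_psum_shifts:
  fixes f :: "rat poly" and x :: rat
  assumes "x \<noteq> 0"
  defines "G \<equiv> psum f" and "u \<equiv> 1 / x"
  shows "u * poly G x = poly (poly_shift 1 G) x"
    and "u ^ 2 * poly G x = coeff G 1 * u + poly (poly_shift 2 G) x"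
    and "u ^ 3 * poly G x = coeff G 1 * u ^ 2 + coeff G 2 * u + poly (poly_shift 3 G) x"
    and "u ^ 4 * poly G x = coeff G 1 * u ^ 3 + coeff G 2 * u ^ 2 + coeff G 3 * u + poly (poly_shift 4 G) x"
proof -
  have ux: "u * (x * y) = y" for y
    using assms(1) by (simp add: u_def)
  have G: "poly G x = x * poly (poly_shift 1 G) x"
    using poly_poly_shift_Suc[of 0 G x] by (simp add: G_def coeff_psum_0)
  show 1: "u * poly G x = poly (poly_shift 1 G) x"
    by (simp add: G ux)
  \<comment> \<open>One more division by x moves the coefficient of index \<open>k\<close> into the
    singular part; \<open>r'\<close> is what had accumulated before, divided by u in
    \<open>r\<close>.\<close>
  have *: "u ^ Suc i * poly G x = r * u + poly (poly_shift (Suc k) G) x"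
    if "u ^ i * poly G x = r' + poly (poly_shift k G) x" "r * u = r' * u + coeff G k * u" for i r r' k
  proof -
    have "u ^ Suc i * poly G x = u * (r' + poly (poly_shift k G) x)"
      using that(1) by (simp add: mult.assoc)
    also have "\<dots> = r * u + poly (poly_shift (Suc k) G) x"
      unfolding that(2) poly_poly_shift_Suc[of k G x] by (simp add: algebra_simps ux)
    finally show ?thesis .
  qed
  show 2: "u ^ 2 * poly G x = coeff G 1 * u + poly (poly_shift 2 G) x"
    using *[of 1 0 1 "coeff G 1"] 1 by (simp add: numeral_2_eq_2)
  show 3: "u ^ 3 * poly G x = coeff G 1 * u ^ 2 + coeff G 2 * u + poly (poly_shift 3 G) x"
    using *[of 2 "coeff G 1 * u" 2 "coeff G 1 * u + coeff G 2"] 2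
    by (simp add: eval_nat_numeral algebra_simps)
  show "u ^ 4 * poly G x = coeff G 1 * u ^ 3 + coeff G 2 * u ^ 2 + coeff G 3 * u + poly (poly_shift 4 G) x"
    using *[of 3 "coeff G 1 * u ^ 2 + coeff G 2 * u" 3 "coeff G 1 * u ^ 2 + coeff G 2 * u + coeff G 3"] 3
    by (simp add: eval_nat_numeral algebra_simps)
qed

text \<open>With G = \<open>psum f\<close>, the difference H_m G(m) - H_{m-1} G(m-1) is f(m) H_{m-1}
  + G(m)/m, and G(m)/m is polynomial in m.\<close>

lemma hsum_1:
  "hsum 1 f n = mhs n [1] * poly (psum f) (of_nat n)
     - poly (psum (poly_shift 1 (psum f))) (of_nat n)"
proof (induction n)
  case (Suc n)
  let ?x = "of_nat (Suc n) :: rat"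
  have "?x \<noteq> 0" by (simp del: of_nat_Suc)
  \<comment> \<open>Replacing G(n+1) by G(n) + f(n+1) makes the expansions match the induction
    hypothesis.\<close>
  note sh = poly_psum_shifts[OF this, of f, unfolded poly_psum_Suc]
  show ?case
    using Suc sh
    unfolding hsum_Suc mhs_Suc mhs_Nil poly_psum_Suc power_one_right
    by algebra
qed (simp add: hsum_0 mhs_0 poly_0_coeff_0 coeff_psum_0)

text \<open>Now H_m^2 = H_{m-1}^2 + 2 H_{m-1}/m + 1/m^2. The singular part c_1/m of G(m)/m^2 sums to
  c_1 H_n.\<close>

lemma hsum_2:
  "hsum 2 f n = mhs n [1] ^ 2 * poly (psum f) (of_nat n)
     - 2 * hsum 1 (poly_shift 1 (psum f)) n
     - poly (psum (poly_shift 2 (psum f))) (of_nat n)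
     - coeff (psum f) 1 * mhs n [1]"
proof (induction n)
  case (Suc n)
  let ?x = "of_nat (Suc n) :: rat"
  have "?x \<noteq> 0" by (simp del: of_nat_Suc)
  note sh = poly_psum_shifts[OF this, of f, unfolded poly_psum_Suc]
  show ?case
    using Suc sh
    unfolding hsum_Suc mhs_Suc mhs_Nil poly_psum_Suc power_one_right
    by algebra
qed (simp add: hsum_0 mhs_0 poly_0_coeff_0 coeff_psum_0)

text \<open>The singular terms are 3 c_1 H_{m-1}/m + c_1/m^2 + c_2/m, where c_i is the i-th
  coefficient of G. The sum of H_{m-1}/m is (H_n^2 - H_n(2))/2, which explains the factors 3/2 and
  1/2.\<close>

lemma hsum_3:
  "hsum 3 f n = mhs n [1] ^ 3 * poly (psum f) (of_nat n)
     - 3 * hsum 2 (poly_shift 1 (psum f)) n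
     - 3 * hsum 1 (poly_shift 2 (psum f)) n
     - poly (psum (poly_shift 3 (psum f))) (of_nat n)
     - 3 / 2 * coeff (psum f) 1 * mhs n [1] ^ 2 + 1 / 2 * coeff (psum f) 1 * mhs n [2]
     - coeff (psum f) 2 * mhs n [1]"
proof (induction n)
  case (Suc n)
  let ?x = "of_nat (Suc n) :: rat"
  have "?x \<noteq> 0" by (simp del: of_nat_Suc)
  note sh = poly_psum_shifts[OF this, of f, unfolded poly_psum_Suc]
  have "mhs (Suc n) [2] = mhs n [2] + (1 / ?x) ^ 2"
    by (simp add: mhs_Suc mhs_Nil power_divide del: of_nat_Suc)
  then show ?case
    using Suc sh
    unfolding hsum_Suc mhs_Suc[of _ 1] mhs_Nil poly_psum_Suc power_one_right
    by algebra
qed (simp add: hsum_0 mhs_0 poly_0_coeff_0 coeff_psum_0)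

text \<open>The singular terms are 6 c_1 H_{m-1}^2/m + 4 H_{m-1} (c_1/m^2 + c_2/m) + c_1/m^3 +
  c_2/m^2 + c_3/m. Telescoping H_m^3 shows that H_{m-1}^2/m sums to (H_n^3 - 3 H_n(2,1) -
  H_n(3))/3.\<close>

lemma hsum_4:
  "hsum 4 f n = mhs n [1] ^ 4 * poly (psum f) (of_nat n)
     - 4 * hsum 3 (poly_shift 1 (psum f)) n
     - 6 * hsum 2 (poly_shift 2 (psum f)) n
     - 4 * hsum 1 (poly_shift 3 (psum f)) n
     - poly (psum (poly_shift 4 (psum f))) (of_nat n)
     - 2 * coeff (psum f) 1 * mhs n [1] ^ 3
     + 2 * coeff (psum f) 1 * mhs n [2, 1] + coeff (psum f) 1 * mhs n [3]
     - 2 * coeff (psum f) 2 * mhs n [1] ^ 2 + coeff (psum f) 2 * mhs n [2]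
     - coeff (psum f) 3 * mhs n [1]"
proof (induction n)
  case (Suc n)
  let ?x = "of_nat (Suc n) :: rat"
  have "?x \<noteq> 0" by (simp del: of_nat_Suc)
  note sh = poly_psum_shifts[OF this, of f, unfolded poly_psum_Suc]
  have "mhs (Suc n) [2] = mhs n [2] + (1 / ?x) ^ 2"
    "mhs (Suc n) [3] = mhs n [3] + (1 / ?x) ^ 3"
    "mhs (Suc n) [2, 1] = mhs n [2, 1] + mhs n [1] * (1 / ?x) ^ 2"
    by (simp_all add: mhs_Suc mhs_Nil power_divide del: of_nat_Suc)
  then show ?case
    using Suc sh
    unfolding hsum_Suc mhs_Suc[of _ 1] mhs_Nil poly_psum_Suc power_one_right
    by algebra
qed (simp add: hsum_0 mhs_0 poly_0_coeff_0 coeff_psum_0)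

section \<open>The identity for monomials and its linear extension\<close>

lemma umbral_smult: "umbral (smult c f) = c * umbral f"
  by (simp add: umbral_eq_sum[of _ "degree f"] sum_distrib_left degree_smult_le mult.assoc)

text \<open>Unrolls the recursions for x^p. The C-polynomials free of harmonic numbers belong to the
  compositions (i_1, ..., i_s) of 4: their entries are i_1 + ... + i_t - t, their coefficients
  multinomial with sign (-1)^s. The part -6 + 4 = -2 in front of H_n(2) is -4 times the 1/2 from
  \<open>hsum_3\<close>.\<close>

lemma hsum_4_monom:
  "hsum 4 (monom 1 p) n = mhs n [1] ^ 4 * (\<Sum>m=1..n. of_nat m ^ p)
     + poly (24 * C_poly p [0, 0, 0, 0] - 12 * C_poly p [0, 0, 1] - 12 * C_poly p [0, 1, 1]
        - 12 * C_poly p [1, 1, 1] + 4 * C_poly p [0, 2] + 6 * C_poly p [1, 2]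
        + 4 * C_poly p [2, 2] - C_poly p [3]) (of_nat n)
     + poly (- 24 * C_poly p [0, 0, 0] - [: 12 * umbral (D_poly p [0]) :]
        + 12 * C_poly p [0, 1] + 12 * C_poly p [1, 1]
        + [: 2 * umbral (pderiv (D_poly p [])) :]
        + [: umbral ((6 * (D_poly p [] - [: bernoulli p :])) div [:0, 1:]) :]
        - 4 * C_poly p [2]
        - [: of_nat p * (of_nat p - 1) / 6 * bernoulli (p - 2) :]) (of_nat n) * mhs n [1]
     + poly (12 * C_poly p [0, 0] + [: 6 * umbral (D_poly p []) :] - 6 * C_poly p [1]
        - [: of_nat p * bernoulli (p - 1) :]) (of_nat n) * mhs n [1] ^ 2
     + poly (- 4 * C_poly p [0] - [: 2 * bernoulli p :]) (of_nat n) * mhs n [1] ^ 3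
     + poly [: - 6 * umbral (D_poly p []) + 4 * umbral (D_poly p [])
        + of_nat p / 2 * bernoulli (p - 1) :] (of_nat n) * mhs n [2]
     + 2 * bernoulli p * mhs n [2, 1] + bernoulli p * mhs n [3]"
proof -
  \<comment> \<open>An entry b after a last entry l corresponds to a shift by b + 1 - l.\<close>
  have C1: "psum (poly_shift 1 (C_poly p [])) = C_poly p [0]"
    "psum (poly_shift 2 (C_poly p [])) = C_poly p [1]"
    "psum (poly_shift 3 (C_poly p [])) = C_poly p [2]"
    "psum (poly_shift 4 (C_poly p [])) = C_poly p [3]"
    using C_poly_snoc[of "[]" 0 p] C_poly_snoc[of "[]" 1 p] C_poly_snoc[of "[]" 2 p]
      C_poly_snoc[of "[]" 3 p] by (simp_all add: eval_nat_numeral)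
  have C2: "psum (poly_shift 1 (C_poly p [0])) = C_poly p [0, 0]"
    "psum (poly_shift 2 (C_poly p [0])) = C_poly p [0, 1]"
    "psum (poly_shift 3 (C_poly p [0])) = C_poly p [0, 2]"
    "psum (poly_shift 1 (C_poly p [1])) = C_poly p [1, 1]"
    "psum (poly_shift 2 (C_poly p [1])) = C_poly p [1, 2]"
    "psum (poly_shift 1 (C_poly p [2])) = C_poly p [2, 2]"
    using C_poly_snoc[of "[0]" 0 p] C_poly_snoc[of "[0]" 1 p] C_poly_snoc[of "[0]" 2 p]
      C_poly_snoc[of "[1]" 1 p] C_poly_snoc[of "[1]" 2 p] C_poly_snoc[of "[2]" 2 p]
    by (simp_all add: eval_nat_numeral)
  have C3: "psum (poly_shift 1 (C_poly p [0, 0])) = C_poly p [0, 0, 0]"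
    "psum (poly_shift 2 (C_poly p [0, 0])) = C_poly p [0, 0, 1]"
    "psum (poly_shift 1 (C_poly p [0, 1])) = C_poly p [0, 1, 1]"
    "psum (poly_shift 1 (C_poly p [1, 1])) = C_poly p [1, 1, 1]"
    "psum (poly_shift 1 (C_poly p [0, 0, 0])) = C_poly p [0, 0, 0, 0]"
    using C_poly_snoc[of "[0, 0]" 0 p] C_poly_snoc[of "[0, 0]" 1 p] C_poly_snoc[of "[0, 1]" 1 p]
      C_poly_snoc[of "[1, 1]" 1 p] C_poly_snoc[of "[0, 0, 0]" 0 p]
    by (simp_all add: eval_nat_numeral)
  have D: "D_poly p as = poly_shift 1 (C_poly p as)" for as
    unfolding D_poly_def by (rule div_X_eq_poly_shift)
  have psum_monom_1: "psum (monom 1 p) = C_poly p []"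
    by (simp add: psum_monom C_poly_Nil)
  have c: "coeff (C_poly p []) 1 = bernoulli p"
    "coeff (C_poly p []) 2 = of_nat p / 2 * bernoulli (p - 1)"
    "coeff (C_poly p []) 3 = of_nat p * (of_nat p - 1) / 6 * bernoulli (p - 2)"
    unfolding C_poly_Nil by (rule coeff_faulhaber_1 coeff_faulhaber_2 coeff_faulhaber_3)+
  \<comment> \<open>\<open>C_poly p [0]\<close> is the summation of \<open>D_poly p []\<close>, so
    its low coefficients are umbral values.\<close>
  have c0: "coeff (C_poly p [0]) 1 = umbral (D_poly p [])"
    "coeff (C_poly p [0]) 2 = umbral (pderiv (D_poly p [])) / 2"
    unfolding D C1(1)[symmetric] by (rule coeff_psum_1 coeff_psum_2)+
  have c00: "coeff (C_poly p [0, 0]) 1 = umbral (D_poly p [0])"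
    unfolding D C2(1)[symmetric] by (rule coeff_psum_1)
  \<comment> \<open>Dividing by x twice in total shifts \<open>C_poly p []\<close> by 2; the umbral
    value is then 6 times the linear coefficient of \<open>C_poly p [1]\<close>.\<close>
  have "(6 * (D_poly p [] - [: bernoulli p :])) div [:0, 1:] = smult 6 (poly_shift 2 (C_poly p []))"
    unfolding div_X_eq_poly_shift D
    by (rule poly_eqI) (simp add: coeff_poly_shift coeff_pCons numeral_poly numeral_2_eq_2)
  hence c1: "umbral ((6 * (D_poly p [] - [: bernoulli p :])) div [:0, 1:]) = 6 * coeff (C_poly p [1]) 1"
    unfolding C1(2)[symmetric] coeff_psum_1 by (simp add: umbral_smult)
  have G: "poly (C_poly p []) (of_nat n) = (\<Sum>m=1..n. of_nat m ^ p)"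
    by (simp add: C_poly_Nil poly_faulhaber)
  have num: "poly (numeral k) y = (numeral k :: rat)" for k and y :: rat
    by (simp add: numeral_poly)
  show ?thesis
    unfolding hsum_4 hsum_3 hsum_2 hsum_1 psum_monom_1 C1 C2 C3 c c0 c00 c1 G
    by (simp add: algebra_simps num c0 c00)
qed

theorem theorem2p11:
  fixes d :: nat and a :: "nat \<Rightarrow> rat" and F :: "rat poly"
  assumes F: "F = (\<Sum>p\<le>d. monom (a p) p)"
  shows "degree (P_poly d a) \<le> d + 1 \<and> degree (Q0_poly d a) \<le> d + 1 \<and>
         degree (Q1_poly d a) \<le> d + 1 \<and> degree (Q2_poly d a) \<le> d + 1 \<and>
         degree (Q3_poly d a) \<le> d + 1 \<and>
         (\<forall>n::nat. n \<ge> 1 \<longrightarrow>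
           (\<Sum>m=1..n. poly F (of_nat m) * mhs (m - 1) [1] ^ 4) =
             mhs n [1] ^ 4 * (\<Sum>m=1..n. poly F (of_nat m))
             + poly (Q0_poly d a) (of_nat n)
             + poly (Q1_poly d a) (of_nat n) * mhs n [1]
             + poly (Q2_poly d a) (of_nat n) * mhs n [1] ^ 2
             + poly (Q3_poly d a) (of_nat n) * mhs n [1] ^ 3
             + poly (P_poly d a) (of_nat n) * mhs n [2]
             + 2 * umbral F * mhs n [2, 1]
             + umbral F * mhs n [3])"
proof (intro conjI allI impI)
  have C: "degree (C_poly p as) \<le> d + 1" if "p \<le> d" for p as
    using degree_C_poly[of p as] that by simp
  have num: "degree (numeral k * f) \<le> d + 1" "degree (- numeral k * f) \<le> d + 1"
    if "degree f \<le> d + 1" for k and f :: "rat poly"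
    using that by (simp_all add: numeral_poly order.trans[OF degree_smult_le])
  note deg = degree_sum_le degree_add_le degree_diff_le order.trans[OF degree_smult_le] num C
  show "degree (P_poly d a) \<le> d + 1"
    unfolding P_poly_def by (intro deg) simp_all
  show "degree (Q0_poly d a) \<le> d + 1"
    unfolding Q0_poly_def by (intro deg) simp_all
  show "degree (Q1_poly d a) \<le> d + 1"
    unfolding Q1_poly_def by (intro deg) simp_all
  show "degree (Q2_poly d a) \<le> d + 1"
    unfolding Q2_poly_def by (intro deg) simp_all
  show "degree (Q3_poly d a) \<le> d + 1"
    unfolding Q3_poly_def by (intro deg) simp_all
next
  fix n :: nat
  have coeff_F: "coeff F i = (if i \<le> d then a i else 0)" for i
    by (simp add: F coeff_sum)
  have "degree F \<le> d"
    unfolding F by (intro degree_sum_le) (auto intro: order.trans[OF degree_monom_le])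
  hence umbral_F: "umbral F = (\<Sum>p\<le>d. a p * bernoulli p)"
    by (simp add: umbral_eq_sum coeff_F)
  have poly_F: "poly F x = (\<Sum>p\<le>d. a p * x ^ p)" for x
    by (simp add: F poly_sum poly_monom)
  \<comment> \<open>Both sides of the identity are linear in F, which reduces it to
    monomials.\<close>
  have "(\<Sum>m=1..n. poly F (of_nat m) * mhs (m - 1) [1] ^ 4) = (\<Sum>p\<le>d. a p * hsum 4 (monom 1 p) n)"
    unfolding hsum_def poly_F sum_distrib_left sum_distrib_right
    by (subst sum.swap) (simp add: poly_monom mult.assoc)
  also have "\<dots> = mhs n [1] ^ 4 * (\<Sum>m=1..n. poly F (of_nat m))
             + poly (Q0_poly d a) (of_nat n)
             + poly (Q1_poly d a) (of_nat n) * mhs n [1]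
             + poly (Q2_poly d a) (of_nat n) * mhs n [1] ^ 2
             + poly (Q3_poly d a) (of_nat n) * mhs n [1] ^ 3
             + poly (P_poly d a) (of_nat n) * mhs n [2]
             + 2 * umbral F * mhs n [2, 1]
             + umbral F * mhs n [3]"
  proof -
    have sum_F: "(\<Sum>m=1..n. poly F (of_nat m)) = (\<Sum>p\<le>d. a p * (\<Sum>m=1..n. of_nat m ^ p))"
      unfolding poly_F sum_distrib_left by (rule sum.swap)
    show ?thesis
      unfolding sum_F hsum_4_monom umbral_F P_poly_def Q0_poly_def Q1_poly_def Q2_poly_def Q3_poly_def
        poly_sum poly_smult sum_distrib_left sum_distrib_right distrib_left sum.distrib
      by (simp only: mult_ac)
  qed
  finally show "(\<Sum>m=1..n. poly F (of_nat m) * mhs (m - 1) [1] ^ 4) = \<dots>" .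
qed

end
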